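(* Let $\Pi=\langle\mathcal V,\mathcal O,s_I,s_\star\rangle$ be a planning task in transition normal form, let $\mathcal F$ be a finite set of features for $\Pi$, and let $\{\sigma_o\}_{o\in\mathcal O}$ be a collection of orderings of $\mathcal V$, one ordering $\sigma_o$ for each operator $o$. Then the set of solutions to the system of linear constraints $$\sum_{f\in\mathcal F}w(f)[s_\star\models f]\le 0,$$ $$\Delta^{\mathrm{ind}}_o+\mathrm{Aux}_{\Psi_o}\le\mathrm{cost}(o)\qquad\text{for each operator } o\in\mathcal O,$$ $$P_{\mathrm{LP}(\Psi_o,\sigma_o)}\qquad\text{for each operator } o\in\mathcal O,$$ projected on the feature weights $(w(f))_{f\in\mathcal F}$, is exactly the set of weight functions $w:\mathcal F\to\mathbb R$ of admissible and consistent potential heuristics for $\Pi$ over $\mathcal F$.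
   Context: Planning tasks. A planning task in transition normal form (TNF) is $\Pi=\langle\mathcal V,\mathcal O,s_I,s_\star\rangle$. $\mathcal V$ is a finite set of variables, each $V\in\mathcal V$ with a finite nonempty domain $\mathrm{dom}(V)$. A fact is a pair $\langle V,v\rangle$ with $V\in\mathcal V$, $v\in\mathrm{dom}(V)$. A partial variable assignment $p$ maps a subset $\mathrm{vars}(p)\subseteq\mathcal V$ to values in the respective domains (also viewed as a set of facts); a state is an assignment with $\mathrm{vars}(s)=\mathcal V$; $\mathcal S$ is the set of all states. $s_I$ (initial state) and $s_\star$ (the unique goal state) are states. $\mathcal O$ is a finite set of operators; each $o$ has a precondition $\mathrm{pre}(o)$ and an effect $\mathrm{eff}(o)$, both partial variable assignments with $\mathrm{vars}(\mathrm{pre}(o))=\mathrm{vars}(\mathrm{eff}(o))=:\mathrm{vars}(o)$, and a cost $\mathrm{cost}(o)$, a non-negative integer. Operator $o$ is applicable in state $s$ if $s$ agrees with $\mathrm{pre}(o)$ on $\mathrm{vars}(o)$; applying it gives the state $s[\![o]\!]$ that agrees with $\mathrm{eff}(o)$ on $\mathrm{vars}(o)$ and with $s$ elsewhere. An $s$-plan is a finite sequence of operators successively applicable starting from $s$ and ending in $s_\star$; its cost is the sum of its operator costs; $h^*(s)$ is the minimal cost of an $s$-plan ($\infty$ if there is none). A heuristic $h:\mathcal S\to\mathbb R\cup\{-\infty,\infty\}$ is admissible if $h(s)\le h^*(s)$ for all $s$, and consistent if $h(s)\le\mathrm{cost}(o)+h(s[\![o]\!])$ for all states $s$ and all operators $o$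 applicable in $s$. A feature is a conjunction of facts; $\mathrm{vars}(f)$ is the set of variables it mentions. For a (partial) assignment $p$, $p\models f$ means all facts of $f$ belong to $p$; $[\cdot]$ is the $0/1$ indicator. The potential heuristic over $\mathcal F$ with weights $w:\mathcal F\to\mathbb R$ is $\varphi(s)=\sum_{f\in\mathcal F}w(f)[s\models f]$. Notation for a fixed operator $o$. $\mathcal F$ is partitioned into irrelevant features (no variable in common with $\mathrm{vars}(o)$), context-independent features $\mathcal F^{\mathrm{ind}}_o$ (mentioning only variables in $\mathrm{vars}(o)$), and the remaining context-dependent features $\mathcal F^{\mathrm{ctx}}_o$ (mentioning variables both inside and outside $\mathrm{vars}(o)$). Put $\Delta^{\mathrm{ind}}_o=\sum_{f\in\mathcal F^{\mathrm{ind}}_o}w(f)([\mathrm{pre}(o)\models f]-[\mathrm{eff}(o)\models f])$. For $f\in\mathcal F^{\mathrm{ctx}}_o$ let $\psi^f_o$ be the function with scope $\mathrm{vars}(f)\setminus\mathrm{vars}(o)$ mapping an assignment $\nu$ of these variables to the linear expression $\psi^f_o(\nu)=w(f)([\mathrm{pre}(o)\cup\nu\models f]-[\mathrm{eff}(o)\cup\nu\models f])\in\{0,w(f),-w(f)\}$ in the unknowns $w(f)$. Let $\Psi_o$ be the family of scoped functions $\langle\mathrm{vars}(f)\setminus\mathrm{vars}(o),\psi^f_o\rangle$, $f\in\mathcal F^{\mathrm{ctx}}_o$. Construction of $P_{\mathrm{LP}(\Psi,\sigma)}$ (bucket elimination) for a finite family $\Psi$ of scoped functions $\langle S,\psi\rangle$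 ($S\subseteq\mathcal V$, $\psi$ mapping $\mathrm{dom}(S)$, the set of assignments to $S$, to linear expressions in the unknowns $w(f)$) and an ordering $\sigma=\langle X_1,\dots,X_n\rangle$ of $\mathcal V$: (1) Start with empty buckets $B_0,\dots,B_n$; put each $\langle S,\psi\rangle\in\Psi$ into $B_i$ where $X_i$ is the largest variable of $S$ w.r.t. $\sigma$, or into $B_0$ if $S=\emptyset$. (2) For $i=n,n-1,\dots,1$: let $\langle S_j,\psi_j\rangle$, $j=1,\dots,k_i$, be the scoped functions currently in $B_i$, and $S_{X_i}=(\bigcup_jS_j)\setminus\{X_i\}$. For each $\nu\in\mathrm{dom}(S_{X_i})$ introduce a new auxiliary variable $\mathrm{Aux}_{X_i,\nu}$ and the equation $\mathrm{Aux}_{X_i,\nu}=\max_{x_i\in\mathrm{dom}(X_i)}\sum_{j=1}^{k_i}\psi_j((\nu\cup\{X_i\mapsto x_i\})|_{S_j})$. Let $\psi_{X_i}(\nu)=\mathrm{Aux}_{X_i,\nu}$ (a variable symbol), and add $\langle S_{X_i},\psi_{X_i}\rangle$ to the bucket $B_j$ where $X_j$ is the largest variable of $S_{X_i}$, or to $B_0$ if $S_{X_i}=\emptyset$. (3) Introduce the auxiliary variable $\mathrm{Aux}_\Psi$ and the equation $\mathrm{Aux}_\Psi=\sum_j\psi_j(\emptyset)$, the sum being over the scoped functions in $B_0$. Every generated equation has the form $\mathrm{Aux}=\max_je_j$ with finitely many linear expressions $e_j$; $P_{\mathrm{LP}(\Psi,\sigma)}$ is the set of linear constraints obtained by replacing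 each such equation by the inequalities $\mathrm{Aux}\ge e_j$ for all $j$. In the combined system, the auxiliary variables for different operators are distinct, and the unknowns (all real) are the $w(f)$ and all auxiliary variables. *)

theory Defs
  imports Main "HOL-Library.Extended_Real" "HOL-Library.FuncSet" "HOL-Library.Multiset"
    "HOL-Library.Poly_Mapping"
begin

section \<open>Planning tasks in transition normal form\<close>

type_synonym ('v, 'd) assignment = "'v \<rightharpoonup> 'd"

record ('v, 'd, 'a) task =
  variables :: "'v set"
  domain :: "'v \<Rightarrow> 'd set"
  operators :: "'a set"
  pre :: "'a \<Rightarrow> ('v, 'd) assignment"
  eff :: "'a \<Rightarrow> ('v, 'd) assignment"
  cost :: "'a \<Rightarrow> nat"
  initial :: "('v, 'd) assignment"
  goal :: "('v, 'd) assignment"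

definition assignments :: "('v \<Rightarrow> 'd set) \<Rightarrow> 'v set \<Rightarrow> ('v, 'd) assignment set" where
  "assignments D S = {p. dom p = S \<and> (\<forall>v d. p v = Some d \<longrightarrow> d \<in> D v)}"

definition states :: "('v, 'd, 'a) task \<Rightarrow> ('v, 'd) assignment set" where
  "states \<T> = assignments (domain \<T>) (variables \<T>)"

definition partial_assignments :: "('v, 'd, 'a) task \<Rightarrow> ('v, 'd) assignment set" where
  "partial_assignments \<T> = (\<Union>S \<in> Pow (variables \<T>). assignments (domain \<T>) S)"

definition tnf_task :: "('v, 'd, 'a) task \<Rightarrow> bool" where
  "tnf_task \<T> \<longleftrightarrow>
     finite (variables \<T>) \<and>
     (\<forall>v \<in> variables \<T>. finite (domain \<T> v) \<and> domain \<T> v \<noteq> {}) \<and>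
     finite (operators \<T>) \<and>
     (\<forall>a \<in> operators \<T>. pre \<T> a \<in> partial_assignments \<T> \<and> eff \<T> a \<in> partial_assignments \<T> \<and>
        dom (pre \<T> a) = dom (eff \<T> a)) \<and>
     initial \<T> \<in> states \<T> \<and> goal \<T> \<in> states \<T>"

text \<open>In transition normal form this is also the domain of the effect.\<close>

definition op_vars :: "('v, 'd, 'a) task \<Rightarrow> 'a \<Rightarrow> 'v set" where
  "op_vars \<T> a = dom (pre \<T> a)"

definition applicable :: "('v, 'd, 'a) task \<Rightarrow> 'a \<Rightarrow> ('v, 'd) assignment \<Rightarrow> bool" where
  "applicable \<T> a s \<longleftrightarrow> pre \<T> a \<subseteq>\<^sub>m s"

definition successor :: "('v, 'd, 'a) task \<Rightarrow> ('v, 'd) assignment \<Rightarrow> 'a \<Rightarrow> ('v, 'd) assignment" where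
  "successor \<T> s a = s ++ eff \<T> a"

primrec is_plan :: "('v, 'd, 'a) task \<Rightarrow> ('v, 'd) assignment \<Rightarrow> 'a list \<Rightarrow> bool" where
  "is_plan \<T> s [] \<longleftrightarrow> s = goal \<T>"
| "is_plan \<T> s (a # as) \<longleftrightarrow>
     a \<in> operators \<T> \<and> applicable \<T> a s \<and> is_plan \<T> (successor \<T> s a) as"

text \<open>On \<^typ>\<open>enat\<close> the infimum of a nonempty set is its least element, and the infimum of the
  empty set is \<open>\<infinity>\<close>.\<close>

definition h_star :: "('v, 'd, 'a) task \<Rightarrow> ('v, 'd) assignment \<Rightarrow> enat" where
  "h_star \<T> s = Inf {enat (\<Sum>a\<leftarrow>as. cost \<T> a) | as. is_plan \<T> s as}"


section \<open>Heuristics\<close>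

definition admissible :: "('v, 'd, 'a) task \<Rightarrow> (('v, 'd) assignment \<Rightarrow> ereal) \<Rightarrow> bool" where
  "admissible \<T> h \<longleftrightarrow> (\<forall>s \<in> states \<T>. h s \<le> ereal_of_enat (h_star \<T> s))"

definition consistent :: "('v, 'd, 'a) task \<Rightarrow> (('v, 'd) assignment \<Rightarrow> ereal) \<Rightarrow> bool" where
  "consistent \<T> h \<longleftrightarrow>
     (\<forall>s \<in> states \<T>. \<forall>a \<in> operators \<T>. applicable \<T> a s \<longrightarrow>
        h s \<le> ereal (real (cost \<T> a)) + h (successor \<T> s a))"

text \<open>A conjunction of facts is the set of its conjuncts; it may be empty, and it may contain
  two facts about the same variable, in which case no assignment satisfies it.\<close>

type_synonym ('v, 'd) feature = "('v \<times> 'd) set"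

definition features :: "('v, 'd, 'a) task \<Rightarrow> ('v, 'd) feature set" where
  "features \<T> = Pow (SIGMA v : variables \<T>. domain \<T> v)"

definition feature_vars :: "('v, 'd) feature \<Rightarrow> 'v set" where
  "feature_vars f = fst ` f"

definition satisfies :: "('v, 'd) assignment \<Rightarrow> ('v, 'd) feature \<Rightarrow> bool" where
  "satisfies p f \<longleftrightarrow> f \<subseteq> Map.graph p"

definition potential ::
  "('v, 'd) feature set \<Rightarrow> (('v, 'd) feature \<Rightarrow> real) \<Rightarrow> ('v, 'd) assignment \<Rightarrow> real" where
  "potential F w s = (\<Sum>f\<in>F. w f * of_bool (satisfies s f))"


section \<open>Linear expressions and constraints\<close>

type_synonym 'u linexpr = "'u \<Rightarrow>\<^sub>0 real"

definition lin_eval :: "('u \<Rightarrow> real) \<Rightarrow> 'u linexpr \<Rightarrow> real" where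
  "lin_eval x e = (\<Sum>u \<in> Poly_Mapping.keys e. Poly_Mapping.lookup e u * x u)"

abbreviation lin_var :: "'u \<Rightarrow> 'u linexpr" where
  "lin_var u \<equiv> Poly_Mapping.single u 1"

text \<open>The pair \<open>(e, c)\<close> stands for the constraint \<open>e \<le> c\<close>.\<close>

type_synonym 'u lin_constraint = "'u linexpr \<times> real"

definition solutions :: "'u lin_constraint set \<Rightarrow> ('u \<Rightarrow> real) set" where
  "solutions C = {x. \<forall>(e, c) \<in> C. lin_eval x e \<le> c}"


section \<open>Bucket elimination\<close>

text \<open>The tag of type \<open>'t\<close> keeps the auxiliary variables of several runs of bucket elimination
  distinct.\<close>

datatype ('w, 't, 'v, 'd) unknown =
    Weight 'w
  | Aux 't 'v "('v, 'd) assignment"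
  | Aux_total 't

type_synonym ('w, 't, 'v, 'd) scoped_fun =
  "'v set \<times> (('v, 'd) assignment \<Rightarrow> ('w, 't, 'v, 'd) unknown linexpr)"

type_synonym ('w, 't, 'v, 'd) buckets = "nat \<Rightarrow> ('w, 't, 'v, 'd) scoped_fun multiset"

text \<open>The pair \<open>(u, E)\<close> stands for the equation \<open>u = max E\<close>.\<close>

type_synonym ('w, 't, 'v, 'd) max_equation =
  "('w, 't, 'v, 'd) unknown \<times> ('w, 't, 'v, 'd) unknown linexpr set"

definition is_ordering :: "'v set \<Rightarrow> 'v list \<Rightarrow> bool" where
  "is_ordering V \<sigma> \<longleftrightarrow> distinct \<sigma> \<and> set \<sigma> = V"

text \<open>Positions in the ordering \<open>\<sigma> = \<langle>X\<^sub>1, \<dots>, X\<^sub>n\<rangle>\<close> count from 1, so that \<open>X\<^sub>i = \<sigma> ! (i - 1)\<close>.\<close>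

definition bucket_index :: "'v list \<Rightarrow> 'v set \<Rightarrow> nat" where
  "bucket_index \<sigma> S =
     (if S = {} then 0 else Max {i \<in> {1..length \<sigma>}. \<sigma> ! (i - 1) \<in> S})"

definition initial_buckets ::
  "'v list \<Rightarrow> ('w, 't, 'v, 'd) scoped_fun multiset \<Rightarrow> ('w, 't, 'v, 'd) buckets" where
  "initial_buckets \<sigma> \<Psi> = (\<lambda>i. {# \<psi> \<in># \<Psi>. bucket_index \<sigma> (fst \<psi>) = i #})"

definition bucket_scope :: "('w, 't, 'v, 'd) scoped_fun multiset \<Rightarrow> 'v \<Rightarrow> 'v set" where
  "bucket_scope B X = (\<Union>(S, \<psi>) \<in> set_mset B. S) - {X}"

definition bucket_sum ::
  "('w, 't, 'v, 'd) scoped_fun multiset \<Rightarrow> ('v, 'd) assignment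
     \<Rightarrow> ('w, 't, 'v, 'd) unknown linexpr" where
  "bucket_sum B \<nu> = (\<Sum>(S, \<psi>) \<in># B. \<psi> (\<nu> |` S))"

definition bucket_equations ::
  "('v \<Rightarrow> 'd set) \<Rightarrow> 't \<Rightarrow> 'v \<Rightarrow> ('w, 't, 'v, 'd) scoped_fun multiset
     \<Rightarrow> ('w, 't, 'v, 'd) max_equation set" where
  "bucket_equations D t X B =
     {(Aux t X \<nu>, {bucket_sum B (\<nu>(X \<mapsto> x)) | x. x \<in> D X}) | \<nu>.
        \<nu> \<in> assignments D (bucket_scope B X)}"

definition add_to_bucket ::
  "'v list \<Rightarrow> ('w, 't, 'v, 'd) scoped_fun \<Rightarrow> ('w, 't, 'v, 'd) buckets
     \<Rightarrow> ('w, 't, 'v, 'd) buckets" where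
  "add_to_bucket \<sigma> \<psi> B =
     (let j = bucket_index \<sigma> (fst \<psi>) in B(j := add_mset \<psi> (B j)))"

definition eliminate ::
  "('v \<Rightarrow> 'd set) \<Rightarrow> 't \<Rightarrow> 'v list \<Rightarrow> nat
     \<Rightarrow> ('w, 't, 'v, 'd) buckets \<times> ('w, 't, 'v, 'd) max_equation set
     \<Rightarrow> ('w, 't, 'v, 'd) buckets \<times> ('w, 't, 'v, 'd) max_equation set" where
  "eliminate D t \<sigma> i = (\<lambda>(B, E).
     let X = \<sigma> ! (i - 1) in
       (add_to_bucket \<sigma> (bucket_scope (B i) X, \<lambda>\<nu>. lin_var (Aux t X \<nu>)) B,
        E \<union> bucket_equations D t X (B i)))"

definition elimination_equations ::
  "('v \<Rightarrow> 'd set) \<Rightarrow> 't \<Rightarrow> 'v list \<Rightarrow> ('w, 't, 'v, 'd) scoped_fun multiset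
     \<Rightarrow> ('w, 't, 'v, 'd) max_equation set" where
  "elimination_equations D t \<sigma> \<Psi> =
     (let (B, E) = fold (eliminate D t \<sigma>) (rev [1..<Suc (length \<sigma>)]) (initial_buckets \<sigma> \<Psi>, {})
      in insert (Aux_total t, {bucket_sum (B 0) Map.empty}) E)"

definition P_LP ::
  "('v \<Rightarrow> 'd set) \<Rightarrow> 't \<Rightarrow> 'v list \<Rightarrow> ('w, 't, 'v, 'd) scoped_fun multiset
     \<Rightarrow> ('w, 't, 'v, 'd) unknown lin_constraint set" where
  "P_LP D t \<sigma> \<Psi> =
     {(e - lin_var u, 0) | u E e. (u, E) \<in> elimination_equations D t \<sigma> \<Psi> \<and> e \<in> E}"


section \<open>The linear constraints for potential heuristics\<close>

type_synonym ('v, 'd, 'a) lp_unknown = "(('v, 'd) feature, 'a, 'v, 'd) unknown"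

text \<open>The empty feature has no variable in common with an operator, so it counts as irrelevant
  and the three classes form a partition.\<close>

definition irrelevant_features ::
  "('v, 'd, 'a) task \<Rightarrow> ('v, 'd) feature set \<Rightarrow> 'a \<Rightarrow> ('v, 'd) feature set" where
  "irrelevant_features \<T> F a = {f \<in> F. feature_vars f \<inter> op_vars \<T> a = {}}"

definition ind_features ::
  "('v, 'd, 'a) task \<Rightarrow> ('v, 'd) feature set \<Rightarrow> 'a \<Rightarrow> ('v, 'd) feature set" where
  "ind_features \<T> F a =
     {f \<in> F. feature_vars f \<subseteq> op_vars \<T> a} - irrelevant_features \<T> F a"

definition ctx_features ::
  "('v, 'd, 'a) task \<Rightarrow> ('v, 'd) feature set \<Rightarrow> 'a \<Rightarrow> ('v, 'd) feature set" where
  "ctx_features \<T> F a = F - irrelevant_features \<T> F a - ind_features \<T> F a"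

definition \<Delta>_ind ::
  "('v, 'd, 'a) task \<Rightarrow> ('v, 'd) feature set \<Rightarrow> 'a \<Rightarrow> ('v, 'd, 'a) lp_unknown linexpr" where
  "\<Delta>_ind \<T> F a = (\<Sum>f \<in> ind_features \<T> F a.
     Poly_Mapping.single (Weight f)
       (of_bool (satisfies (pre \<T> a) f) - of_bool (satisfies (eff \<T> a) f)))"

definition \<psi>_ctx ::
  "('v, 'd, 'a) task \<Rightarrow> 'a \<Rightarrow> ('v, 'd) feature \<Rightarrow> ('v, 'd) assignment
     \<Rightarrow> ('v, 'd, 'a) lp_unknown linexpr" where
  "\<psi>_ctx \<T> a f \<nu> = Poly_Mapping.single (Weight f)
     (of_bool (satisfies (pre \<T> a ++ \<nu>) f) - of_bool (satisfies (eff \<T> a ++ \<nu>) f))"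

definition \<Psi>_ctx ::
  "('v, 'd, 'a) task \<Rightarrow> ('v, 'd) feature set \<Rightarrow> 'a
     \<Rightarrow> (('v, 'd) feature, 'a, 'v, 'd) scoped_fun multiset" where
  "\<Psi>_ctx \<T> F a =
     {# (feature_vars f - op_vars \<T> a, \<psi>_ctx \<T> a f). f \<in># mset_set (ctx_features \<T> F a) #}"

definition potential_lp ::
  "('v, 'd, 'a) task \<Rightarrow> ('v, 'd) feature set \<Rightarrow> ('a \<Rightarrow> 'v list)
     \<Rightarrow> ('v, 'd, 'a) lp_unknown lin_constraint set" where
  "potential_lp \<T> F \<sigma> =
     {(\<Sum>f\<in>F. Poly_Mapping.single (Weight f) (of_bool (satisfies (goal \<T>) f)), 0)} \<union>
     {(\<Delta>_ind \<T> F a + lin_var (Aux_total a), real (cost \<T> a)) | a. a \<in> operators \<T>} \<union>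
     (\<Union>a \<in> operators \<T>. P_LP (domain \<T>) a (\<sigma> a) (\<Psi>_ctx \<T> F a))"

text \<open>Weight functions on \<open>F\<close> are represented as functions that are \<^const>\<open>undefined\<close> outside
  \<open>F\<close>.\<close>

definition project_weights ::
  "('v, 'd) feature set \<Rightarrow> (('v, 'd, 'a) lp_unknown \<Rightarrow> real) \<Rightarrow> ('v, 'd) feature \<Rightarrow> real" where
  "project_weights F x = (\<lambda>f\<in>F. x (Weight f))"

end

theory Submission
  imports Defs
begin

text \<open>
  Over the reals, eliminating \<open>X\<^sub>i\<close> keeps the maximum over all states of the sum of the remaining
  scoped functions, so \<open>Aux\<^sub>\<Psi>\<close> can be chosen as low as the maximum over all states \<open>s\<close> of
  \<open>\<Sum>\<^sub>f \<psi>\<^sup>f\<^sub>o(s)\<close> and no lower. That sum plus \<open>\<Delta>\<^sup>i\<^sup>n\<^sup>d\<^sub>o\<close> is the potential difference between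
  \<open>s\<close> overridden by \<open>pre(o)\<close> and by \<open>eff(o)\<close>, so the operator constraints say exactly that the
  potential is consistent. A consistent heuristic is admissible iff it is nonpositive at the goal.
\<close>

section \<open>Linear expressions\<close>

text \<open>Keys outside the support have coefficient 0. This allows expressions with different
  supports to be evaluated over one common index set.\<close>

lemma lin_eval_superset:
  assumes "finite A" "Poly_Mapping.keys e \<subseteq> A"
  shows "lin_eval x e = (\<Sum>u\<in>A. Poly_Mapping.lookup e u * x u)"
  unfolding lin_eval_def using assms
  by (intro sum.mono_neutral_left) (auto simp: in_keys_iff)

lemma lin_eval_0 [simp]: "lin_eval x 0 = 0"
  by (simp add: lin_eval_def)

lemma lin_eval_single [simp]: "lin_eval x (Poly_Mapping.single u c) = c * x u"
  by (subst lin_eval_superset [of "{u}"]) auto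

lemma lin_eval_add [simp]: "lin_eval x (a + b) = lin_eval x a + lin_eval x b"
proof -
  let ?A = "Poly_Mapping.keys a \<union> Poly_Mapping.keys b"
  have "lin_eval x e = (\<Sum>u\<in>?A. Poly_Mapping.lookup e u * x u)" if "e \<in> {a, b, a + b}" for e
    using that Poly_Mapping.keys_add [of a b] by (intro lin_eval_superset) auto
  then show ?thesis
    by (simp add: lookup_add distrib_right sum.distrib)
qed

lemma lin_eval_diff [simp]: "lin_eval x (a - b) = lin_eval x a - lin_eval x b"
  using lin_eval_add [of x "a - b" b] by simp

lemma lin_eval_sum: "lin_eval x (\<Sum>i\<in>A. g i) = (\<Sum>i\<in>A. lin_eval x (g i))"
  by (induction A rule: infinite_finite_induct) auto

text \<open>Used to change a valuation at fresh auxiliary unknowns without disturbing the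
  expressions generated earlier.\<close>

lemma lin_eval_cong:
  "(\<And>u. u \<in> Poly_Mapping.keys e \<Longrightarrow> x u = y u) \<Longrightarrow> lin_eval x e = lin_eval y e"
  by (simp add: lin_eval_def)


section \<open>Bucket elimination\<close>

lemma bucket_sum_empty [simp]: "bucket_sum {#} \<nu> = 0"
  by (simp add: bucket_sum_def)

lemma bucket_sum_add_mset [simp]:
  "bucket_sum (add_mset (S, \<psi>) B) \<nu> = \<psi> (\<nu> |` S) + bucket_sum B \<nu>"
  by (simp add: bucket_sum_def)

lemma bucket_sum_cong:
  assumes "\<And>S \<psi> v. (S, \<psi>) \<in># B \<Longrightarrow> v \<in> S \<Longrightarrow> \<mu> v = \<nu> v"
  shows "bucket_sum B \<mu> = bucket_sum B \<nu>"
proof -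
  have "\<mu> |` S = \<nu> |` S" if "(S, \<psi>) \<in># B" for S \<psi>
    using assms [OF that] by (auto simp: restrict_map_def)
  then show ?thesis
    unfolding bucket_sum_def by (intro arg_cong [where f = sum_mset] image_mset_cong) auto
qed

lemma keys_bucket_sum:
  assumes "\<And>S \<psi>. (S, \<psi>) \<in># B \<Longrightarrow> Poly_Mapping.keys (\<psi> (\<nu> |` S)) \<subseteq> U"
  shows "Poly_Mapping.keys (bucket_sum B \<nu>) \<subseteq> U"
  using assms
proof (induction B)
  case (add p B)
  obtain S \<psi> where p: "p = (S, \<psi>)" by (cases p)
  have "Poly_Mapping.keys (\<psi> (\<nu> |` S)) \<subseteq> U" "Poly_Mapping.keys (bucket_sum B \<nu>) \<subseteq> U"
    using add.prems p by (simp, intro add.IH) simp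
  then show ?case
    using Poly_Mapping.keys_add [of "\<psi> (\<nu> |` S)" "bucket_sum B \<nu>"] unfolding p by auto
qed simp

text \<open>Since \<sigma> is distinct, every position occupied by \<open>S\<close> is at most
  \<open>i\<close>, and the largest of them bounds all the others. "No variable after the j-th" is
  encoded by \<open>take j\<close>.\<close>

lemma bucket_index_prefix:
  assumes "distinct \<sigma>" "i \<le> length \<sigma>" "S \<subseteq> set (take i \<sigma>)"
  shows "bucket_index \<sigma> S \<le> i \<and> S \<subseteq> set (take (bucket_index \<sigma> S) \<sigma>)"
proof (cases "S = {}")
  case True
  then show ?thesis by (simp add: bucket_index_def)
next
  case False
  let ?M = "{k \<in> {1..length \<sigma>}. \<sigma> ! (k - 1) \<in> S}"
  have pos: "\<exists>m<i. v = \<sigma> ! m" if "v \<in> S" for v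
  proof -
    have "v \<in> set (take i \<sigma>)" using that assms(3) by blast
    then show ?thesis using assms(2) by (auto simp: in_set_conv_nth)
  qed
  \<comment> \<open>List positions \<open>m\<close> count from 0, members of \<open>?M\<close> from
    1.\<close>
  have mem: "Suc m \<in> ?M" if "\<sigma> ! m \<in> S" "m < i" for m
    using that assms by auto
  have fin: "finite ?M" by simp
  have "?M \<noteq> {}" using False pos mem by blast
  moreover have "k \<le> i" if k: "k \<in> ?M" for k
  proof -
    obtain m where "m < i" "\<sigma> ! (k - 1) = \<sigma> ! m" using pos k by blast
    then have "k - 1 = m" using k assms by (auto simp: nth_eq_iff_index_eq)
    then show ?thesis using \<open>m < i\<close> by auto
  qed
  moreover have "v \<in> set (take (Max ?M) \<sigma>)" if v: "v \<in> S" for v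
  proof -
    obtain m where m: "m < i" "v = \<sigma> ! m" using pos v by blast
    then have "Suc m \<le> Max ?M" using v mem fin by (intro Max_ge) auto
    then show ?thesis using m assms by (auto simp: in_set_conv_nth intro!: exI [of _ m])
  qed
  ultimately show ?thesis
    using False fin by (auto simp: bucket_index_def)
qed

section \<open>Elimination as a recursion on the number of remaining variables\<close>

text \<open>The bucket half of \<open>eliminate\<close> at step \<open>Suc i\<close>, with the
  variable at list position \<open>i\<close>. Bucket \<open>Suc i\<close> is not emptied; from here
  on only buckets up to \<open>i\<close> are read.\<close>

definition eliminated ::
  "'t \<Rightarrow> 'v list \<Rightarrow> nat \<Rightarrow> ('w, 't, 'v, 'd) buckets \<Rightarrow> ('w, 't, 'v, 'd) buckets" where
  "eliminated t \<sigma> i B =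
     add_to_bucket \<sigma> (bucket_scope (B (Suc i)) (\<sigma> ! i), \<lambda>\<nu>. lin_var (Aux t (\<sigma> ! i) \<nu>)) B"

text \<open>The equations still to be generated from an intermediate bucket state. Unlike the
  accumulating fold, this form supports induction from an arbitrary state \<open>B\<close>.\<close>

primrec remaining_equations ::
  "('v \<Rightarrow> 'd set) \<Rightarrow> 't \<Rightarrow> 'v list \<Rightarrow> nat \<Rightarrow> ('w, 't, 'v, 'd) buckets
     \<Rightarrow> ('w, 't, 'v, 'd) max_equation set" where
  "remaining_equations D t \<sigma> 0 B = {(Aux_total t, {bucket_sum (B 0) Map.empty})}"
| "remaining_equations D t \<sigma> (Suc i) B =
     bucket_equations D t (\<sigma> ! i) (B (Suc i)) \<union> remaining_equations D t \<sigma> i (eliminated t \<sigma> i B)"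

text \<open>The reversed list starts with \<open>Suc i\<close>, so the induction peels off one
  elimination. The accumulator \<open>E\<close> has to be arbitrary for this.\<close>

lemma fold_eliminate:
  "(let (B', E') = fold (eliminate D t \<sigma>) (rev [1..<Suc i]) (B, E)
    in insert (Aux_total t, {bucket_sum (B' 0) Map.empty}) E') = E \<union> remaining_equations D t \<sigma> i B"
proof (induction i arbitrary: B E)
  case (Suc i)
  have "eliminate D t \<sigma> (Suc i) (B, E) =
      (eliminated t \<sigma> i B, E \<union> bucket_equations D t (\<sigma> ! i) (B (Suc i)))"
    by (simp add: eliminate_def eliminated_def Let_def)
  then show ?case
    using Suc [of "eliminated t \<sigma> i B" "E \<union> bucket_equations D t (\<sigma> ! i) (B (Suc i))"]
    by (simp add: Un_assoc)
qed simp

lemma elimination_equations_eq: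
  "elimination_equations D t \<sigma> \<Psi> =
     remaining_equations D t \<sigma> (length \<sigma>) (initial_buckets \<sigma> \<Psi>)"
  unfolding elimination_equations_def fold_eliminate by simp

text \<open>The relaxed reading of a max equation, as in \<open>P_LP\<close>: the left-hand unknown
  is an upper bound of all candidates, not necessarily their maximum.\<close>

definition satisfies_equations ::
  "('u \<Rightarrow> real) \<Rightarrow> ('u \<times> 'u linexpr set) set \<Rightarrow> bool" where
  "satisfies_equations x Q \<longleftrightarrow> (\<forall>(u, E) \<in> Q. \<forall>e \<in> E. lin_eval x e \<le> x u)"

lemma satisfies_equations_Un [simp]:
  "satisfies_equations x (P \<union> Q) \<longleftrightarrow> satisfies_equations x P \<and> satisfies_equations x Q"
  by (auto simp: satisfies_equations_def)

lemma solutions_P_LP: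
  "x \<in> solutions (P_LP D t \<sigma> \<Psi>) \<longleftrightarrow> satisfies_equations x (elimination_equations D t \<sigma> \<Psi>)"
  by (fastforce simp: solutions_def P_LP_def satisfies_equations_def)

lemma satisfies_bucket_equations:
  "satisfies_equations x (bucket_equations D t X B) \<longleftrightarrow>
     (\<forall>\<nu> \<in> assignments D (bucket_scope B X). \<forall>d \<in> D X.
        lin_eval x (bucket_sum B (\<nu>(X \<mapsto> d))) \<le> x (Aux t X \<nu>))"
proof -
  have "bucket_equations D t X B =
      (\<lambda>\<nu>. (Aux t X \<nu>, (\<lambda>d. bucket_sum B (\<nu>(X \<mapsto> d))) ` D X))
        ` assignments D (bucket_scope B X)"
    by (simp add: bucket_equations_def image_def Setcompr_eq_image)
  then show ?thesis
    by (simp add: satisfies_equations_def)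
qed

section \<open>Invariant of the buckets\<close>

definition valid_buckets ::
  "'v list \<Rightarrow> ('w, 't, 'v, 'd) unknown set \<Rightarrow> nat \<Rightarrow> ('w, 't, 'v, 'd) buckets \<Rightarrow> bool" where
  "valid_buckets \<sigma> U i B \<longleftrightarrow>
     (\<forall>j\<le>i. \<forall>(S, \<psi>) \<in># B j. S \<subseteq> set (take j \<sigma>) \<and> (\<forall>\<nu>. Poly_Mapping.keys (\<psi> \<nu>) \<subseteq> U))"

lemma valid_bucketsD:
  assumes "valid_buckets \<sigma> U i B" "(S, \<psi>) \<in># B j" "j \<le> i"
  shows "S \<subseteq> set (take j \<sigma>)" "Poly_Mapping.keys (\<psi> \<nu>) \<subseteq> U"
  using assms by (fastforce simp: valid_buckets_def)+

lemma valid_buckets_mono: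
  "valid_buckets \<sigma> U i B \<Longrightarrow> U \<subseteq> U' \<Longrightarrow> valid_buckets \<sigma> U' i B"
  unfolding valid_buckets_def by blast

lemma keys_valid_buckets:
  "valid_buckets \<sigma> U i B \<Longrightarrow> j \<le> i \<Longrightarrow> Poly_Mapping.keys (bucket_sum (B j) \<nu>) \<subseteq> U"
  by (intro keys_bucket_sum) (rule valid_bucketsD)

lemma bucket_sum_valid_cong:
  assumes "valid_buckets \<sigma> U i B" "j \<le> i" "\<And>v. v \<in> set (take j \<sigma>) \<Longrightarrow> \<mu> v = \<nu> v"
  shows "bucket_sum (B j) \<mu> = bucket_sum (B j) \<nu>"
  using valid_bucketsD(1) [OF assms(1) _ assms(2)] assms(3)
  by (intro bucket_sum_cong) blast

lemma valid_initial_buckets: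
  assumes "distinct \<sigma>"
    and "\<And>S \<psi>. (S, \<psi>) \<in># \<Psi> \<Longrightarrow> S \<subseteq> set \<sigma> \<and> (\<forall>\<nu>. Poly_Mapping.keys (\<psi> \<nu>) \<subseteq> U)"
  shows "valid_buckets \<sigma> U (length \<sigma>) (initial_buckets \<sigma> \<Psi>)"
proof -
  have "S \<subseteq> set (take j \<sigma>) \<and> (\<forall>\<nu>. Poly_Mapping.keys (\<psi> \<nu>) \<subseteq> U)"
    if "(S, \<psi>) \<in># initial_buckets \<sigma> \<Psi> j" for j S \<psi>
  proof -
    have "(S, \<psi>) \<in># \<Psi>" "j = bucket_index \<sigma> S"
      using that by (simp_all add: initial_buckets_def)
    then show ?thesis
      using assms bucket_index_prefix [of \<sigma> "length \<sigma>" S] by simp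
  qed
  then show ?thesis unfolding valid_buckets_def by blast
qed

section \<open>A single elimination step\<close>

context
  fixes \<sigma> :: "'v list" and i :: nat
  assumes distinct: "distinct \<sigma>" and less: "i < length \<sigma>"
begin

text \<open>The last variable that bucket \<open>Suc i\<close> may mention is the one removed. Hence
  the new function lands in a bucket that is still to be processed.\<close>

lemma bucket_scope_prefix:
  assumes "valid_buckets \<sigma> U (Suc i) B"
  shows "bucket_scope (B (Suc i)) (\<sigma> ! i) \<subseteq> set (take i \<sigma>)"
proof -
  have "S \<subseteq> insert (\<sigma> ! i) (set (take i \<sigma>))" if "(S, \<psi>) \<in># B (Suc i)" for S \<psi>
    using valid_bucketsD(1) [OF assms that] less by (simp add: take_Suc_conv_app_nth)
  then show ?thesis unfolding bucket_scope_def by blast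
qed

lemma nth_notin_take: "j \<le> i \<Longrightarrow> \<sigma> ! i \<notin> set (take j \<sigma>)"
  using distinct less by (auto simp: in_set_conv_nth nth_eq_iff_index_eq)

lemma eliminated_index:
  assumes "valid_buckets \<sigma> U (Suc i) B"
  shows "bucket_index \<sigma> (bucket_scope (B (Suc i)) (\<sigma> ! i)) \<le> i"
  using bucket_index_prefix [OF distinct _ bucket_scope_prefix [OF assms]] less by simp

text \<open>A function in a new bucket is either an old one or the newly added auxiliary function.
  Only the latter forces \<open>U\<close> to grow, by the auxiliary unknowns of the eliminated
  variable.\<close>

lemma valid_eliminated:
  assumes "valid_buckets \<sigma> U (Suc i) B" "U \<subseteq> U'" "range (Aux t (\<sigma> ! i)) \<subseteq> U'"
  shows "valid_buckets \<sigma> U' i (eliminated t \<sigma> i B)"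
proof -
  have "S \<subseteq> set (take j \<sigma>) \<and> (\<forall>\<nu>. Poly_Mapping.keys (\<psi> \<nu>) \<subseteq> U')"
    if "j \<le> i" "(S, \<psi>) \<in># eliminated t \<sigma> i B j" for j S \<psi>
  proof (cases "(S, \<psi>) \<in># B j")
    case True
    then show ?thesis
      using valid_bucketsD [OF assms(1), of S \<psi> j] that assms(2) by fastforce
  next
    case False
    with that have "S = bucket_scope (B (Suc i)) (\<sigma> ! i)" "j = bucket_index \<sigma> S"
      "\<psi> = (\<lambda>\<nu>. lin_var (Aux t (\<sigma> ! i) \<nu>))"
      by (auto simp: eliminated_def add_to_bucket_def Let_def split: if_splits)
    then show ?thesis
      using bucket_index_prefix [OF distinct _ bucket_scope_prefix [OF assms(1)]] less assms(3)
      by auto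
  qed
  then show ?thesis unfolding valid_buckets_def by blast
qed

text \<open>The bookkeeping of one step: bucket \<open>Suc i\<close> leaves the range of summation,
  and in its place one auxiliary unknown enters some bucket of index at most
  \<open>i\<close>.\<close>

lemma total_eliminated:
  assumes "valid_buckets \<sigma> U (Suc i) B"
  shows "(\<Sum>j\<le>i. lin_eval x (bucket_sum (eliminated t \<sigma> i B j) s)) =
    x (Aux t (\<sigma> ! i) (s |` bucket_scope (B (Suc i)) (\<sigma> ! i)))
      + (\<Sum>j\<le>i. lin_eval x (bucket_sum (B j) s))"
proof -
  let ?S = "bucket_scope (B (Suc i)) (\<sigma> ! i)"
  have "lin_eval x (bucket_sum (eliminated t \<sigma> i B j) s) =
      (if j = bucket_index \<sigma> ?S then x (Aux t (\<sigma> ! i) (s |` ?S)) else 0)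
        + lin_eval x (bucket_sum (B j) s)" for j
    by (simp add: eliminated_def add_to_bucket_def Let_def)
  then show ?thesis
    using eliminated_index [OF assms] by (simp add: sum.distrib)
qed

text \<open>All scopes in the bucket lie in its scope together with the eliminated variable. This
  connects the equations, indexed by assignments of the scope, with full states.\<close>

lemma bucket_sum_restrict:
  assumes "s (\<sigma> ! i) = Some d"
  shows "bucket_sum (B (Suc i)) ((s |` bucket_scope (B (Suc i)) (\<sigma> ! i))(\<sigma> ! i \<mapsto> d)) =
    bucket_sum (B (Suc i)) s"
  using assms by (intro bucket_sum_cong) (fastforce simp: bucket_scope_def restrict_map_def)

end

section \<open>The total is an upper bound for all states\<close>

lemma restrict_assignments:
  "s \<in> assignments D V \<Longrightarrow> S \<subseteq> V \<Longrightarrow> s |` S \<in> assignments D S"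
  by (auto simp: assignments_def restrict_map_def split: if_splits)

text \<open>For a fixed state, each elimination replaces the sum of a bucket by an unknown that is
  at least as large, so the total never decreases on the way to \<open>Aux_total t\<close>.\<close>

lemma total_le_Aux_total:
  assumes "distinct \<sigma>" "s \<in> assignments D (set \<sigma>)"
    and "i \<le> length \<sigma>" "valid_buckets \<sigma> U i B"
    and "satisfies_equations x (remaining_equations D t \<sigma> i B)"
  shows "(\<Sum>j\<le>i. lin_eval x (bucket_sum (B j) s)) \<le> x (Aux_total t)"
  using assms(3-)
proof (induction i arbitrary: B U)
  case 0
  have "bucket_sum (B 0) s = bucket_sum (B 0) Map.empty"
    by (rule bucket_sum_valid_cong [OF 0(2)]) simp_all
  then show ?case using 0(3) by (simp add: satisfies_equations_def)
next
  case (Suc i)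
  let ?X = "\<sigma> ! i" and ?S = "bucket_scope (B (Suc i)) (\<sigma> ! i)"
  have i: "i < length \<sigma>" using Suc.prems by simp
  have "?X \<in> set \<sigma>" using i by simp
  \<comment> \<open>Among the candidates of the maximum, the one given by the value of
    \<open>s\<close> itself is used.\<close>
  then obtain d where d: "s ?X = Some d" "d \<in> D ?X"
    using assms(2) unfolding assignments_def by blast
  have "?S \<subseteq> set \<sigma>"
    using bucket_scope_prefix [OF assms(1) i Suc.prems(2)] set_take_subset [of i \<sigma>] by blast
  then have "s |` ?S \<in> assignments D ?S"
    using assms(2) by (intro restrict_assignments)
  moreover have "satisfies_equations x (bucket_equations D t ?X (B (Suc i)))"
    using Suc.prems(3) by simp
  ultimately have
    "lin_eval x (bucket_sum (B (Suc i)) ((s |` ?S)(?X \<mapsto> d))) \<le> x (Aux t ?X (s |` ?S))"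
    using d(2) unfolding satisfies_bucket_equations by blast
  then have "lin_eval x (bucket_sum (B (Suc i)) s) \<le> x (Aux t ?X (s |` ?S))"
    using bucket_sum_restrict [OF assms(1) i, of s d B] d(1) by simp
  then have "(\<Sum>j\<le>Suc i. lin_eval x (bucket_sum (B j) s)) \<le>
      (\<Sum>j\<le>i. lin_eval x (bucket_sum (eliminated t \<sigma> i B j) s))"
    by (simp add: total_eliminated [OF assms(1) i Suc.prems(2)])
  also have "\<dots> \<le> x (Aux_total t)"
  proof (rule Suc.IH)
    show "valid_buckets \<sigma> UNIV i (eliminated t \<sigma> i B)"
      by (rule valid_eliminated [OF assms(1) i Suc.prems(2)]) auto
  qed (use Suc.prems(1,3) in simp_all)
  finally show ?case .
qed

section \<open>A solution attaining the maximum\<close>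

text \<open>The unknowns introduced by the steps still to come, and hence free to be chosen. For
  simplicity \<open>\<nu>\<close> ranges over all partial maps.\<close>

definition remaining_unknowns :: "'t \<Rightarrow> 'v list \<Rightarrow> nat \<Rightarrow> ('w, 't, 'v, 'd) unknown set" where
  "remaining_unknowns t \<sigma> i = insert (Aux_total t) {Aux t X \<nu> | X \<nu>. X \<in> set (take i \<sigma>)}"

text \<open>Every auxiliary unknown is set to the actual maximum of its candidates. The values are
  fixed in order of elimination; the maximizing state is assembled in the opposite order, choosing
  for each variable a value that is optimal given those of the smaller variables.\<close>

lemma Aux_total_attained:
  fixes x :: "('w, 't, 'v, 'd) unknown \<Rightarrow> real"
  assumes "distinct \<sigma>" and dom: "\<And>v. v \<in> set \<sigma> \<Longrightarrow> finite (D v) \<and> D v \<noteq> {}"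
    and "i \<le> length \<sigma>" "valid_buckets \<sigma> (- remaining_unknowns t \<sigma> i) i B"
  shows "\<exists>y. \<exists>s \<in> assignments D (set \<sigma>). (\<forall>u. u \<notin> remaining_unknowns t \<sigma> i \<longrightarrow> y u = x u) \<and>
    satisfies_equations y (remaining_equations D t \<sigma> i B) \<and>
    y (Aux_total t) = (\<Sum>j\<le>i. lin_eval x (bucket_sum (B j) s))"
  using assms(3-)
proof (induction i arbitrary: B x)
  case 0
  \<comment> \<open>Bucket 0 has only empty scopes, so any state attains its sum; nonempty domains
    provide one.\<close>
  define s where "s = (\<lambda>v. if v \<in> set \<sigma> then Some (SOME d. d \<in> D v) else None)"
  have "(SOME d. d \<in> D v) \<in> D v" if "v \<in> set \<sigma>" for v
    using dom [OF that] by (simp add: some_in_eq)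
  then have s: "s \<in> assignments D (set \<sigma>)"
    by (auto simp: s_def assignments_def split: if_splits)
  have eq: "bucket_sum (B 0) s = bucket_sum (B 0) Map.empty"
    by (rule bucket_sum_valid_cong [OF 0(2)]) simp_all
  let ?y = "x(Aux_total t := lin_eval x (bucket_sum (B 0) s))"
  have "Aux_total t \<notin> Poly_Mapping.keys (bucket_sum (B 0) s)"
    using keys_valid_buckets [OF 0(2), of 0 s] by (auto simp: remaining_unknowns_def)
  then have "lin_eval ?y (bucket_sum (B 0) s) = lin_eval x (bucket_sum (B 0) s)"
    by (intro lin_eval_cong) auto
  then have "satisfies_equations ?y (remaining_equations D t \<sigma> 0 B)"
    by (simp add: satisfies_equations_def eq)
  moreover have "?y u = x u" if "u \<notin> remaining_unknowns t \<sigma> 0" for u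
    using that by (auto simp: remaining_unknowns_def)
  moreover have "?y (Aux_total t) = (\<Sum>j\<le>0. lin_eval x (bucket_sum (B j) s))"
    by simp
  ultimately show ?case using s by blast
next
  case (Suc i)
  define X where "X = \<sigma> ! i"
  define S where "S = bucket_scope (B (Suc i)) X"
  define g where "g = (\<lambda>\<nu> d. lin_eval x (bucket_sum (B (Suc i)) (\<nu>(X \<mapsto> d))))"
  \<comment> \<open>The auxiliary unknowns of \<open>X\<close> receive their maxima before the
    induction hypothesis is applied, since later expressions may contain them.\<close>
  define x' where "x' = (\<lambda>u. case u of
      Aux t' X' \<nu> \<Rightarrow> if t' = t \<and> X' = X then Max (g \<nu> ` D X) else x u
    | _ \<Rightarrow> x u)"
  have i: "i < length \<sigma>" using Suc.prems by simp
  have X: "X \<in> set \<sigma>" using i by (simp add: X_def)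
  have X_notin: "X \<notin> set (take j \<sigma>)" if "j \<le> i" for j
    using nth_notin_take [OF assms(1) i that] by (simp add: X_def)
  have unknowns: "remaining_unknowns t \<sigma> (Suc i) =
      remaining_unknowns t \<sigma> i \<union> range (Aux t X)"
    using i by (auto simp: remaining_unknowns_def X_def take_Suc_conv_app_nth)
  have x'_other: "x' u = x u" if "u \<notin> range (Aux t X)" for u
    using that by (auto simp: x'_def split: unknown.split)
  \<comment> \<open>By distinctness \<open>X\<close> is not eliminated again, so the later steps
    preserve the values just fixed.\<close>
  have Aux_notin: "Aux t X \<nu> \<notin> remaining_unknowns t \<sigma> i" for \<nu>
    using X_notin [of i] by (auto simp: remaining_unknowns_def)
  have "valid_buckets \<sigma> (- remaining_unknowns t \<sigma> i) i (eliminated t \<sigma> i B)"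
    using Suc.prems(2) Aux_notin
    by (intro valid_eliminated [OF assms(1) i]) (auto simp: unknowns X_def)
  then obtain y s where s: "s \<in> assignments D (set \<sigma>)"
    and y: "\<And>u. u \<notin> remaining_unknowns t \<sigma> i \<Longrightarrow> y u = x' u"
    and sat: "satisfies_equations y (remaining_equations D t \<sigma> i (eliminated t \<sigma> i B))"
    and total: "y (Aux_total t) =
      (\<Sum>j\<le>i. lin_eval x' (bucket_sum (eliminated t \<sigma> i B j) s))"
    using Suc.IH [of "eliminated t \<sigma> i B" x'] i by auto
  have y_other: "y u = x u" if "u \<notin> remaining_unknowns t \<sigma> (Suc i)" for u
    using that y [of u] x'_other [of u] by (auto simp: unknowns)
  have keys: "Poly_Mapping.keys (bucket_sum (B j) \<nu>) \<subseteq> - remaining_unknowns t \<sigma> (Suc i)"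
    if "j \<le> Suc i" for j \<nu>
    using keys_valid_buckets [OF Suc.prems(2) that] .
  have x'_eval: "lin_eval x' (bucket_sum (B j) \<nu>) = lin_eval x (bucket_sum (B j) \<nu>)"
    if "j \<le> Suc i" for j \<nu>
    using keys [OF that, of \<nu>] x'_other by (intro lin_eval_cong) (auto simp: unknowns)
  have y_eval: "lin_eval y (bucket_sum (B (Suc i)) \<nu>) = lin_eval x (bucket_sum (B (Suc i)) \<nu>)"
    for \<nu> using keys [of "Suc i" \<nu>] y_other by (intro lin_eval_cong) auto
  have y_Aux: "y (Aux t X \<nu>) = Max (g \<nu> ` D X)" for \<nu>
    using y [OF Aux_notin] by (simp add: x'_def)
  have "satisfies_equations y (bucket_equations D t X (B (Suc i)))"
    using dom [OF X] by (auto simp: satisfies_bucket_equations y_eval y_Aux g_def)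
  with sat have sat': "satisfies_equations y (remaining_equations D t \<sigma> (Suc i) B)"
    by (simp add: X_def)
  have "Max (g (s |` S) ` D X) \<in> g (s |` S) ` D X"
    using dom [OF X] by (intro Max_in) auto
  then obtain d where d: "d \<in> D X" "Max (g (s |` S) ` D X) = g (s |` S) d" by auto
  \<comment> \<open>The state from the induction hypothesis is changed at \<open>X\<close> to a
    maximizer of the eliminated bucket. The scope \<open>S\<close> and the buckets up to
    \<open>i\<close> do not mention \<open>X\<close>, so their contribution stays the same.\<close>
  let ?s = "s(X \<mapsto> d)"
  have s': "?s \<in> assignments D (set \<sigma>)"
    using s d X by (auto simp: assignments_def)
  have "X \<notin> S" by (simp add: S_def bucket_scope_def)
  then have "?s |` S = s |` S" by (auto simp: restrict_map_def)
  then have "g (s |` S) d = lin_eval x (bucket_sum (B (Suc i)) ?s)"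
    using bucket_sum_restrict [OF assms(1) i, of ?s d B] by (simp add: g_def S_def X_def)
  moreover have "bucket_sum (B j) s = bucket_sum (B j) ?s" if "j \<le> i" for j
    using that X_notin by (intro bucket_sum_valid_cong [OF Suc.prems(2)]) auto
  moreover have "y (Aux_total t) = x' (Aux t X (s |` S)) +
      (\<Sum>j\<le>i. lin_eval x (bucket_sum (B j) s))"
    unfolding total total_eliminated [OF assms(1) i Suc.prems(2)]
    by (simp add: X_def S_def x'_eval)
  ultimately have "y (Aux_total t) = (\<Sum>j\<le>Suc i. lin_eval x (bucket_sum (B j) ?s))"
    using d by (simp add: x'_def)
  then show ?case using s' sat' y_other by blast
qed

text \<open>No equation generated under tag \<open>t\<close> leaves the set \<open>U\<close>. This
  makes it possible to glue the solutions found for different operators.\<close>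

lemma satisfies_remaining_equations_cong:
  assumes "distinct \<sigma>" "Aux_total t \<in> U" "\<And>X. range (Aux t X) \<subseteq> U" "\<And>u. u \<in> U \<Longrightarrow> x u = y u"
    and "i \<le> length \<sigma>" "valid_buckets \<sigma> U i B"
    and "satisfies_equations x (remaining_equations D t \<sigma> i B)"
  shows "satisfies_equations y (remaining_equations D t \<sigma> i B)"
  using assms(5-)
proof (induction i arbitrary: B)
  case 0
  have "lin_eval x (bucket_sum (B 0) Map.empty) = lin_eval y (bucket_sum (B 0) Map.empty)"
    using keys_valid_buckets [OF 0(2)] assms(4) by (intro lin_eval_cong) auto
  then show ?case
    using 0(3) assms(2) assms(4) [of "Aux_total t"] by (simp add: satisfies_equations_def)
next
  case (Suc i)
  have "lin_eval x (bucket_sum (B (Suc i)) \<nu>) = lin_eval y (bucket_sum (B (Suc i)) \<nu>)" for \<nu>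
    using keys_valid_buckets [OF Suc.prems(2)] assms(4) by (intro lin_eval_cong) auto
  moreover have "x (Aux t (\<sigma> ! i) \<nu>) = y (Aux t (\<sigma> ! i) \<nu>)" for \<nu>
    using assms(3) assms(4) by blast
  moreover have "satisfies_equations y (remaining_equations D t \<sigma> i (eliminated t \<sigma> i B))"
  proof (rule Suc.IH)
    show "valid_buckets \<sigma> U i (eliminated t \<sigma> i B)"
      using Suc.prems(1) assms(3) by (intro valid_eliminated [OF assms(1) _ Suc.prems(2)]) auto
  qed (use Suc.prems(1,3) in simp_all)
  ultimately show ?case
    using Suc.prems(3) by (simp add: satisfies_bucket_equations)
qed

text \<open>Each function of \<Psi> goes into exactly one bucket, and none is lost beyond index
  \<open>n\<close>.\<close>

lemma total_initial_buckets:
  assumes "\<And>S \<psi>. (S, \<psi>) \<in># \<Psi> \<Longrightarrow> bucket_index \<sigma> S \<le> n"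
  shows "(\<Sum>j\<le>n. lin_eval x (bucket_sum (initial_buckets \<sigma> \<Psi> j) s)) = lin_eval x (bucket_sum \<Psi> s)"
  using assms
proof (induction \<Psi>)
  case (add p \<Psi>)
  obtain S \<psi> where p: "p = (S, \<psi>)" by (cases p)
  have "lin_eval x (bucket_sum (initial_buckets \<sigma> (add_mset p \<Psi>) j) s) =
      (if j = bucket_index \<sigma> S then lin_eval x (\<psi> (s |` S)) else 0)
        + lin_eval x (bucket_sum (initial_buckets \<sigma> \<Psi> j) s)" for j
    by (simp add: p initial_buckets_def)
  moreover have "(\<Sum>j\<le>n. lin_eval x (bucket_sum (initial_buckets \<sigma> \<Psi> j) s)) =
      lin_eval x (bucket_sum \<Psi> s)"
    by (rule add.IH) (use add.prems in auto)
  moreover have "bucket_index \<sigma> S \<le> n"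
    using add.prems [of S \<psi>] by (simp add: p)
  ultimately show ?case by (simp add: p sum.distrib)
qed (simp add: initial_buckets_def)


section \<open>Potential heuristics\<close>

lemma satisfies_cong:
  "(\<And>v. v \<in> feature_vars f \<Longrightarrow> p v = q v) \<Longrightarrow> satisfies p f \<longleftrightarrow> satisfies q f"
  by (force simp: satisfies_def feature_vars_def Map.graph_def)

lemma potential_cong: "(\<And>f. f \<in> F \<Longrightarrow> w f = w' f) \<Longrightarrow> potential F w = potential F w'"
  by (auto simp: potential_def)

lemma lin_eval_bucket_sum_\<Psi>_ctx:
  assumes "finite F"
  shows "lin_eval x (bucket_sum (\<Psi>_ctx \<T> F a) s) =
    (\<Sum>f\<in>ctx_features \<T> F a.
       lin_eval x (\<psi>_ctx \<T> a f (s |` (feature_vars f - op_vars \<T> a))))"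
  by (simp add: bucket_sum_def \<Psi>_ctx_def image_mset.compositionality comp_def
      flip: sum_unfold_sum_mset lin_eval_sum)

text \<open>Irrelevant features cancel, context-independent ones see only the precondition and the
  effect, and context-dependent ones see \<open>s\<close> only outside
  \<open>op_vars \<T> a\<close>. Overriding \<open>s\<close> by the precondition makes this
  meaningful for every \<open>s\<close>.\<close>

lemma potential_diff:
  assumes "finite F" "dom (pre \<T> a) = dom (eff \<T> a)"
  shows "potential F (\<lambda>f. x (Weight f)) (s ++ pre \<T> a) - potential F (\<lambda>f. x (Weight f)) (s ++ eff \<T> a)
    = lin_eval x (\<Delta>_ind \<T> F a) + lin_eval x (bucket_sum (\<Psi>_ctx \<T> F a) s)"
proof -
  define \<delta> where "\<delta> p q f = x (Weight f) * (of_bool (satisfies p f) - of_bool (satisfies q f))"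
    for p q f
  let ?p = "pre \<T> a" and ?q = "eff \<T> a"
  let ?R = "irrelevant_features \<T> F a" and ?I = "ind_features \<T> F a" and ?C = "ctx_features \<T> F a"
  have dom_q: "v \<in> dom ?q \<longleftrightarrow> v \<in> op_vars \<T> a" for v
    using assms(2) by (simp add: op_vars_def)
  have dom_p: "v \<in> dom ?p \<longleftrightarrow> v \<in> op_vars \<T> a" for v
    by (simp add: op_vars_def)
  \<comment> \<open>Precondition and effect have the same domain, so both override \<open>s\<close>
    on the same variables. The second map is the argument of \<open>satisfies\<close> in
    \<open>\<psi>_ctx\<close>, with \<open>T\<close> the variables of the feature.\<close>
  have override: "(s ++ r) v = (if v \<in> op_vars \<T> a then r v else s v)"
    "(r ++ s |` (T - op_vars \<T> a)) v = (if v \<in> op_vars \<T> a then r v else if v \<in> T then s v else None)"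
    if "r = ?p \<or> r = ?q" for r v T
    using that dom_p [of v] dom_q [of v]
    by (auto simp: map_add_def restrict_map_def split: option.splits)
  have R: "\<delta> (s ++ ?p) (s ++ ?q) f = 0" if "f \<in> ?R" for f
  proof -
    have "satisfies (s ++ ?p) f \<longleftrightarrow> satisfies (s ++ ?q) f"
      using that by (intro satisfies_cong) (auto simp: irrelevant_features_def override)
    then show ?thesis by (simp add: \<delta>_def)
  qed
  have I: "\<delta> (s ++ ?p) (s ++ ?q) f = \<delta> ?p ?q f" if "f \<in> ?I" for f
  proof -
    have "satisfies (s ++ r) f \<longleftrightarrow> satisfies r f" if "r = ?p \<or> r = ?q" for r
      using \<open>f \<in> ?I\<close> that by (intro satisfies_cong) (auto simp: ind_features_def override)
    then show ?thesis by (simp add: \<delta>_def)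
  qed
  have C: "\<delta> (s ++ ?p) (s ++ ?q) f =
      lin_eval x (\<psi>_ctx \<T> a f (s |` (feature_vars f - op_vars \<T> a)))" for f
  proof -
    have "satisfies (s ++ r) f \<longleftrightarrow> satisfies (r ++ s |` (feature_vars f - op_vars \<T> a)) f"
      if "r = ?p \<or> r = ?q" for r
      using that by (intro satisfies_cong) (auto simp: override)
    then show ?thesis by (simp add: \<delta>_def \<psi>_ctx_def)
  qed
  have F: "F = ?R \<union> (?I \<union> ?C)" "?R \<inter> (?I \<union> ?C) = {}" "?I \<inter> ?C = {}"
    by (auto simp: ctx_features_def ind_features_def irrelevant_features_def)
  have fin: "finite ?R" "finite ?I" "finite ?C"
    using assms(1) by (auto simp: ctx_features_def ind_features_def irrelevant_features_def)
  have "potential F (\<lambda>f. x (Weight f)) (s ++ ?p) - potential F (\<lambda>f. x (Weight f)) (s ++ ?q)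
      = (\<Sum>f\<in>F. \<delta> (s ++ ?p) (s ++ ?q) f)"
    by (simp add: potential_def \<delta>_def sum_subtractf right_diff_distrib)
  also have "\<dots> = (\<Sum>f\<in>?R \<union> (?I \<union> ?C). \<delta> (s ++ ?p) (s ++ ?q) f)"
    using F(1) by simp
  also have "\<dots> = (\<Sum>f\<in>?I. \<delta> (s ++ ?p) (s ++ ?q) f) + (\<Sum>f\<in>?C. \<delta> (s ++ ?p) (s ++ ?q) f)"
    using F(2,3) fin R by (simp add: sum.union_disjoint)
  also have "(\<Sum>f\<in>?I. \<delta> (s ++ ?p) (s ++ ?q) f) = lin_eval x (\<Delta>_ind \<T> F a)"
    by (simp add: I \<Delta>_ind_def lin_eval_sum) (simp add: \<delta>_def mult.commute)
  finally show ?thesis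
    by (simp add: C lin_eval_bucket_sum_\<Psi>_ctx [OF assms(1)])
qed

section \<open>Consistency and admissibility\<close>

lemma override_in_states:
  assumes "s \<in> states \<T>" "p \<in> partial_assignments \<T>"
  shows "s ++ p \<in> states \<T>"
proof -
  obtain S where "S \<subseteq> variables \<T>" "p \<in> assignments (domain \<T>) S"
    using assms(2) by (auto simp: partial_assignments_def)
  then show ?thesis
    using assms(1) by (auto simp: states_def assignments_def map_add_Some_iff)
qed

text \<open>Every state becomes applicable after overriding it with the precondition, so consistency can
  be stated over all states.\<close>

lemma consistent_potential_iff:
  assumes "tnf_task \<T>" "finite F"
  shows "consistent \<T> (\<lambda>s. ereal (potential F (\<lambda>f. x (Weight f)) s)) \<longleftrightarrow>
    (\<forall>a \<in> operators \<T>. \<forall>s \<in> states \<T>.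
       lin_eval x (\<Delta>_ind \<T> F a) + lin_eval x (bucket_sum (\<Psi>_ctx \<T> F a) s) \<le> real (cost \<T> a))"
proof -
  let ?\<phi> = "potential F (\<lambda>f. x (Weight f))"
  have op: "pre \<T> a \<in> partial_assignments \<T>" "dom (pre \<T> a) = dom (eff \<T> a)"
    if "a \<in> operators \<T>" for a
    using assms(1) that by (auto simp: tnf_task_def)
  have *: "(\<forall>s \<in> states \<T>. applicable \<T> a s \<longrightarrow>
        ereal (?\<phi> s) \<le> ereal (real (cost \<T> a)) + ereal (?\<phi> (successor \<T> s a))) \<longleftrightarrow>
      (\<forall>s \<in> states \<T>. ?\<phi> (s ++ pre \<T> a) - ?\<phi> (s ++ eff \<T> a) \<le> real (cost \<T> a))"
    (is "?L \<longleftrightarrow> ?R") if a: "a \<in> operators \<T>" for a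
  proof
    assume L: ?L
    show ?R
    proof
      fix s assume "s \<in> states \<T>"
      then have "s ++ pre \<T> a \<in> states \<T>"
        using op(1) [OF a] by (rule override_in_states)
      moreover have "applicable \<T> a (s ++ pre \<T> a)"
        by (simp add: applicable_def)
      \<comment> \<open>The effect covers all variables of the precondition, whose values are
        therefore overwritten.\<close>
      moreover have "successor \<T> (s ++ pre \<T> a) a = s ++ eff \<T> a"
        unfolding successor_def
      proof
        fix v
        have "v \<in> dom (pre \<T> a) \<longleftrightarrow> v \<in> dom (eff \<T> a)" using op(2) [OF a] by simp
        then show "(s ++ pre \<T> a ++ eff \<T> a) v = (s ++ eff \<T> a) v"
          by (auto simp: map_add_def split: option.splits)
      qed
      ultimately show "?\<phi> (s ++ pre \<T> a) - ?\<phi> (s ++ eff \<T> a) \<le> real (cost \<T> a)"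
        using L by fastforce
    qed
  next
    assume R: ?R
    have "s ++ pre \<T> a = s" if "applicable \<T> a s" for s
      using that by (simp add: applicable_def map_add_subsumed2)
    then show ?L using R by (fastforce simp: successor_def)
  qed
  have "consistent \<T> (\<lambda>s. ereal (?\<phi> s)) \<longleftrightarrow> (\<forall>a \<in> operators \<T>. \<forall>s \<in> states \<T>.
      ?\<phi> (s ++ pre \<T> a) - ?\<phi> (s ++ eff \<T> a) \<le> real (cost \<T> a))"
    using * unfolding consistent_def by blast
  then show ?thesis
    using op(2) by (simp add: potential_diff [OF assms(2)])
qed

text \<open>The empty plan gives the goal the value 0 under \<open>h_star\<close>. Conversely, the
  consistency inequalities telescope along any plan and end at the goal, where the potential is at
  most 0.\<close>

lemma admissible_if_consistent:
  fixes \<phi> :: "('v, 'd) assignment \<Rightarrow> real"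
  assumes "tnf_task \<T>" "consistent \<T> (\<lambda>s. ereal (\<phi> s))"
  shows "admissible \<T> (\<lambda>s. ereal (\<phi> s)) \<longleftrightarrow> \<phi> (goal \<T>) \<le> 0"
proof
  assume "admissible \<T> (\<lambda>s. ereal (\<phi> s))"
  then have "ereal (\<phi> (goal \<T>)) \<le> ereal_of_enat (h_star \<T> (goal \<T>))"
    using assms(1) by (auto simp: admissible_def tnf_task_def)
  also have "h_star \<T> (goal \<T>) \<le> enat (\<Sum>a\<leftarrow>[]. cost \<T> a)"
    unfolding h_star_def by (intro Inf_lower CollectI exI [of _ "[]"] conjI refl) simp
  then have "h_star \<T> (goal \<T>) = 0"
    by (simp add: zero_enat_def [symmetric])
  finally show "\<phi> (goal \<T>) \<le> 0" by (simp add: zero_ereal_def)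
next
  assume goal: "\<phi> (goal \<T>) \<le> 0"
  have plan: "\<phi> s \<le> real (\<Sum>a\<leftarrow>as. cost \<T> a)" if "is_plan \<T> s as" "s \<in> states \<T>" for s as
    using that
  proof (induction as arbitrary: s)
    case (Cons a as)
    then have "\<phi> s \<le> real (cost \<T> a) + \<phi> (successor \<T> s a)"
      using assms(2) by (auto simp: consistent_def)
    moreover have "successor \<T> s a \<in> states \<T>"
      using Cons.prems assms(1) by (auto simp: successor_def tnf_task_def intro: override_in_states)
    then have "\<phi> (successor \<T> s a) \<le> real (\<Sum>a\<leftarrow>as. cost \<T> a)"
      using Cons by simp
    ultimately show ?case by simp
  qed (use goal in simp)
  show "admissible \<T> (\<lambda>s. ereal (\<phi> s))"
    unfolding admissible_def
  proof
    fix s assume s: "s \<in> states \<T>"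
    let ?A = "{enat (\<Sum>a\<leftarrow>as. cost \<T> a) | as. is_plan \<T> s as}"
    show "ereal (\<phi> s) \<le> ereal_of_enat (h_star \<T> s)"
    proof (cases "?A = {}")
      case True
      then show ?thesis unfolding h_star_def True by (simp add: Inf_enat_def)
    next
      case False
      \<comment> \<open>\<open>enat\<close> is well-ordered, so the infimum is the cost of an actual
        plan.\<close>
      then have "h_star \<T> s \<in> ?A"
        unfolding h_star_def by (metis (no_types, lifting) all_not_in_conv wellorder_InfI)
      then show ?thesis using plan s by fastforce
    qed
  qed
qed


section \<open>The linear program\<close>

lemma solutions_potential_lp:
  "x \<in> solutions (potential_lp \<T> F \<sigma>) \<longleftrightarrow>
     potential F (\<lambda>f. x (Weight f)) (goal \<T>) \<le> 0 \<and>
     (\<forall>a \<in> operators \<T>. lin_eval x (\<Delta>_ind \<T> F a) + x (Aux_total a) \<le> real (cost \<T> a) \<and>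
        satisfies_equations x (elimination_equations (domain \<T>) a (\<sigma> a) (\<Psi>_ctx \<T> F a)))"
proof -
  have Un: "x \<in> solutions (A \<union> B) \<longleftrightarrow> x \<in> solutions A \<and> x \<in> solutions B" for A B
    by (auto simp: solutions_def)
  have UN: "x \<in> solutions (\<Union>a\<in>A. B a) \<longleftrightarrow> (\<forall>a\<in>A. x \<in> solutions (B a))" for A :: "'c set" and B
    by (auto simp: solutions_def)
  have "x \<in> solutions {(\<Sum>f\<in>F. Poly_Mapping.single (Weight f) (of_bool (satisfies (goal \<T>) f)), 0)}
      \<longleftrightarrow> potential F (\<lambda>f. x (Weight f)) (goal \<T>) \<le> 0"
    by (simp add: solutions_def lin_eval_sum potential_def mult.commute)
  moreover have "x \<in> solutions
        {(\<Delta>_ind \<T> F a + lin_var (Aux_total a), real (cost \<T> a)) | a. a \<in> operators \<T>} \<longleftrightarrow>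
      (\<forall>a \<in> operators \<T>. lin_eval x (\<Delta>_ind \<T> F a) + x (Aux_total a) \<le> real (cost \<T> a))"
    by (fastforce simp: solutions_def)
  ultimately show ?thesis
    unfolding potential_lp_def Un UN solutions_P_LP by blast
qed

context
  fixes \<T> :: "('v, 'd, 'a) task" and F :: "('v, 'd) feature set" and \<sigma> :: "'v list"
  assumes F: "finite F" "F \<subseteq> features \<T>" and ordering: "is_ordering (variables \<T>) \<sigma>"
begin

lemma \<Psi>_ctxD:
  assumes "(S, \<psi>) \<in># \<Psi>_ctx \<T> F a"
  shows "S \<subseteq> set \<sigma>" "Poly_Mapping.keys (\<psi> \<nu>) \<subseteq> range Weight"
proof -
  have "finite (ctx_features \<T> F a)"
    using F(1) by (simp add: ctx_features_def)
  then have "(S, \<psi>) \<in>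
      (\<lambda>f. (feature_vars f - op_vars \<T> a, \<psi>_ctx \<T> a f)) ` ctx_features \<T> F a"
    using assms by (simp add: \<Psi>_ctx_def)
  then obtain f where f: "f \<in> ctx_features \<T> F a" "S = feature_vars f - op_vars \<T> a"
    "\<psi> = \<psi>_ctx \<T> a f"
    by blast
  have "f \<in> features \<T>" using f(1) F(2) unfolding ctx_features_def by blast
  then have "feature_vars f \<subseteq> variables \<T>"
    unfolding features_def feature_vars_def by auto
  then show "S \<subseteq> set \<sigma>" using f(2) ordering unfolding is_ordering_def by blast
  show "Poly_Mapping.keys (\<psi> \<nu>) \<subseteq> range Weight" by (simp add: f(3) \<psi>_ctx_def)
qed

text \<open>Initially only weights occur, so all auxiliary unknowns are fresh.\<close>

lemma valid_initial_buckets_ctx: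
  "valid_buckets \<sigma> (range Weight) (length \<sigma>) (initial_buckets \<sigma> (\<Psi>_ctx \<T> F a))"
  using ordering \<Psi>_ctxD by (intro valid_initial_buckets conjI allI) (simp add: is_ordering_def)

lemma total_initial_buckets_ctx:
  "(\<Sum>j\<le>length \<sigma>. lin_eval x (bucket_sum (initial_buckets \<sigma> (\<Psi>_ctx \<T> F a) j) s)) =
    lin_eval x (bucket_sum (\<Psi>_ctx \<T> F a) s)"
proof (rule total_initial_buckets)
  show "bucket_index \<sigma> S \<le> length \<sigma>" if "(S, \<psi>) \<in># \<Psi>_ctx \<T> F a" for S \<psi>
    using bucket_index_prefix [of \<sigma> "length \<sigma>" S] \<Psi>_ctxD(1) [OF that] ordering
    by (simp add: is_ordering_def)
qed

end

section \<open>The two inclusions\<close>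

text \<open>\<open>Aux_total a\<close> bounds the context-dependent part at every state, so the
  operator constraint bounds the whole potential difference by the cost.\<close>

lemma potential_lp_sound:
  assumes "tnf_task \<T>" "finite F" "F \<subseteq> features \<T>"
    and "\<And>a. a \<in> operators \<T> \<Longrightarrow> is_ordering (variables \<T>) (\<sigma> a)"
    and x: "x \<in> solutions (potential_lp \<T> F \<sigma>)"
  shows "consistent \<T> (\<lambda>s. ereal (potential F (\<lambda>f. x (Weight f)) s))"
  unfolding consistent_potential_iff [OF assms(1,2)]
proof (intro ballI)
  fix a s assume a: "a \<in> operators \<T>" and s: "s \<in> states \<T>"
  have ord: "is_ordering (variables \<T>) (\<sigma> a)" using assms(4) a .
  have "lin_eval x (bucket_sum (\<Psi>_ctx \<T> F a) s) \<le> x (Aux_total a)"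
    unfolding total_initial_buckets_ctx [OF assms(2,3) ord, symmetric]
  proof (rule total_le_Aux_total)
    show "s \<in> assignments (domain \<T>) (set (\<sigma> a))" "distinct (\<sigma> a)"
      using s ord by (auto simp: is_ordering_def states_def)
    show "satisfies_equations x (remaining_equations (domain \<T>) a (\<sigma> a) (length (\<sigma> a))
        (initial_buckets (\<sigma> a) (\<Psi>_ctx \<T> F a)))"
      using x a by (simp add: solutions_potential_lp elimination_equations_eq)
  qed (use valid_initial_buckets_ctx [OF assms(2,3) ord] in auto)
  moreover have "lin_eval x (\<Delta>_ind \<T> F a) + x (Aux_total a) \<le> real (cost \<T> a)"
    using x a by (simp add: solutions_potential_lp)
  ultimately show
    "lin_eval x (\<Delta>_ind \<T> F a) + lin_eval x (bucket_sum (\<Psi>_ctx \<T> F a) s) \<le> real (cost \<T> a)"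
    by simp
qed

text \<open>Each operator separately admits auxiliary values whose total is the context-dependent
  part at some state, which consistency bounds. These partial solutions share only the weights and
  combine into one.\<close>

lemma potential_lp_complete:
  fixes \<T> :: "('v, 'd, 'a) task" and F :: "('v, 'd) feature set"
  assumes "tnf_task \<T>" "finite F" "F \<subseteq> features \<T>"
    and ord: "\<And>a. a \<in> operators \<T> \<Longrightarrow> is_ordering (variables \<T>) (\<sigma> a)"
    and goal: "potential F w (goal \<T>) \<le> 0"
    and consistent: "consistent \<T> (\<lambda>s. ereal (potential F w s))"
  shows "\<exists>x \<in> solutions (potential_lp \<T> F \<sigma>). \<forall>f. x (Weight f) = w f"
proof -
  \<comment> \<open>The 0 is a placeholder: \<open>\<Delta>_ind\<close> and the initial functions
    contain only weights.\<close>
  define x where "x = (\<lambda>u :: ('v, 'd, 'a) lp_unknown. case u of Weight f \<Rightarrow> w f | _ \<Rightarrow> 0)"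
  have xw: "x (Weight f) = w f" for f by (simp add: x_def)
  have bound: "lin_eval x (\<Delta>_ind \<T> F a) + lin_eval x (bucket_sum (\<Psi>_ctx \<T> F a) s) \<le> real (cost \<T> a)"
    if "a \<in> operators \<T>" "s \<in> states \<T>" for a s
    using that consistent consistent_potential_iff [OF assms(1,2), of x] by (simp add: xw)
  let ?eqs = "\<lambda>a. elimination_equations (domain \<T>) a (\<sigma> a) (\<Psi>_ctx \<T> F a)"
  have "\<exists>y. (\<forall>f. y (Weight f) = w f) \<and> satisfies_equations y (?eqs a) \<and>
      lin_eval x (\<Delta>_ind \<T> F a) + y (Aux_total a) \<le> real (cost \<T> a)" if a: "a \<in> operators \<T>" for a
  proof -
    let ?n = "length (\<sigma> a)" and ?B = "initial_buckets (\<sigma> a) (\<Psi>_ctx \<T> F a)"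
    have "valid_buckets (\<sigma> a) (- remaining_unknowns a (\<sigma> a) ?n) ?n ?B"
      using valid_initial_buckets_ctx [OF assms(2,3) ord [OF a]]
      by (rule valid_buckets_mono) (auto simp: remaining_unknowns_def)
    moreover have "distinct (\<sigma> a)" "set (\<sigma> a) = variables \<T>"
      using ord [OF a] by (auto simp: is_ordering_def)
    ultimately obtain y s where s: "s \<in> states \<T>"
      and y: "\<And>u. u \<notin> remaining_unknowns a (\<sigma> a) ?n \<Longrightarrow> y u = x u"
      and sat: "satisfies_equations y (?eqs a)"
      and total: "y (Aux_total a) = (\<Sum>j\<le>?n. lin_eval x (bucket_sum (?B j) s))"
      using Aux_total_attained [of "\<sigma> a" "domain \<T>" ?n a ?B x] assms(1)
      by (auto simp: tnf_task_def states_def elimination_equations_eq)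
    have "y (Weight f) = w f" for f
      using y [of "Weight f"] by (simp add: xw remaining_unknowns_def)
    moreover have "lin_eval x (\<Delta>_ind \<T> F a) + y (Aux_total a) \<le> real (cost \<T> a)"
      unfolding total total_initial_buckets_ctx [OF assms(2,3) ord [OF a]] using bound [OF a s] .
    ultimately show ?thesis using sat by blast
  qed
  then obtain y where y: "\<And>a f. a \<in> operators \<T> \<Longrightarrow> y a (Weight f) = w f"
    "\<And>a. a \<in> operators \<T> \<Longrightarrow> satisfies_equations (y a) (?eqs a)"
    "\<And>a. a \<in> operators \<T> \<Longrightarrow> lin_eval x (\<Delta>_ind \<T> F a) + y a (Aux_total a) \<le> real (cost \<T> a)"
    by metis
  \<comment> \<open>Each auxiliary unknown takes its value from the solution of the operator in its
    tag.\<close>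
  define z where "z = (\<lambda>u. case u of
      Weight f \<Rightarrow> w f | Aux a X \<nu> \<Rightarrow> y a u | Aux_total a \<Rightarrow> y a u)"
  have "satisfies_equations z (?eqs a)" if a: "a \<in> operators \<T>" for a
  proof -
    let ?U = "range Weight \<union> (\<Union>X. range (Aux a X)) \<union> {Aux_total a}"
    show ?thesis
      unfolding elimination_equations_eq
    proof (rule satisfies_remaining_equations_cong [of _ _ ?U "y a"])
      show "valid_buckets (\<sigma> a) ?U (length (\<sigma> a)) (initial_buckets (\<sigma> a) (\<Psi>_ctx \<T> F a))"
        using valid_initial_buckets_ctx [OF assms(2,3) ord [OF a]]
        by (rule valid_buckets_mono) auto
      show "y a u = z u" if "u \<in> ?U" for u
        using that y(1) [OF a] by (auto simp: z_def)
    qed (use ord [OF a] y(2) [OF a] in \<open>auto simp: is_ordering_def elimination_equations_eq\<close>)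
  qed
  moreover have "lin_eval z (\<Delta>_ind \<T> F a) = lin_eval x (\<Delta>_ind \<T> F a)" for a
    by (simp add: \<Delta>_ind_def lin_eval_sum z_def x_def)
  then have "lin_eval z (\<Delta>_ind \<T> F a) + z (Aux_total a) \<le> real (cost \<T> a)"
    if "a \<in> operators \<T>" for a
    using y(3) [OF that] by (simp add: z_def)
  ultimately have "z \<in> solutions (potential_lp \<T> F \<sigma>)"
    using goal by (simp add: solutions_potential_lp z_def)
  moreover have "z (Weight f) = w f" for f
    by (simp add: z_def)
  ultimately show ?thesis by blast
qed

theorem theorem5:
  fixes \<T> :: "('v, 'd, 'a) task"
    and F :: "('v, 'd) feature set"
    and \<sigma> :: "'a \<Rightarrow> 'v list"
  assumes "tnf_task \<T>"
    and "finite F" and "F \<subseteq> features \<T>"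
    and "\<And>a. a \<in> operators \<T> \<Longrightarrow> is_ordering (variables \<T>) (\<sigma> a)"
  shows "project_weights F ` solutions (potential_lp \<T> F \<sigma>) =
    {w \<in> F \<rightarrow>\<^sub>E UNIV.
       admissible \<T> (\<lambda>s. ereal (potential F w s)) \<and>
       consistent \<T> (\<lambda>s. ereal (potential F w s))}"
proof (intro equalityI subsetI)
  fix w assume "w \<in> project_weights F ` solutions (potential_lp \<T> F \<sigma>)"
  then obtain x where x: "x \<in> solutions (potential_lp \<T> F \<sigma>)" and w: "w = project_weights F x"
    by auto
  have \<phi>: "potential F w = potential F (\<lambda>f. x (Weight f))"
    by (rule potential_cong) (simp add: w project_weights_def)
  have "consistent \<T> (\<lambda>s. ereal (potential F w s))"
    unfolding \<phi> using potential_lp_sound [OF assms x] .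
  moreover have "potential F w (goal \<T>) \<le> 0"
    using x by (simp add: \<phi> solutions_potential_lp)
  moreover have "w \<in> F \<rightarrow>\<^sub>E UNIV" by (simp add: w project_weights_def)
  ultimately show "w \<in> {w \<in> F \<rightarrow>\<^sub>E UNIV.
      admissible \<T> (\<lambda>s. ereal (potential F w s)) \<and> consistent \<T> (\<lambda>s. ereal (potential F w s))}"
    using admissible_if_consistent [OF assms(1), of "potential F w"] by simp
next
  fix w assume w: "w \<in> {w \<in> F \<rightarrow>\<^sub>E UNIV.
      admissible \<T> (\<lambda>s. ereal (potential F w s)) \<and> consistent \<T> (\<lambda>s. ereal (potential F w s))}"
  then have "potential F w (goal \<T>) \<le> 0"
    using admissible_if_consistent [OF assms(1), of "potential F w"] by simp
  then obtain x where "x \<in> solutions (potential_lp \<T> F \<sigma>)" "\<And>f. x (Weight f) = w f"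
    using potential_lp_complete [OF assms(1-3), of \<sigma> w] assms(4) w by auto
  \<comment> \<open>Being in \<open>F \<rightarrow>\<^sub>E UNIV\<close>, \<open>w\<close> is
    \<open>undefined\<close> outside \<open>F\<close> and so equals its own restriction to
    \<open>F\<close>.\<close>
  moreover from this w have "project_weights F x = w"
    by (simp add: project_weights_def PiE_restrict [of w F "\<lambda>_. UNIV"])
  ultimately show "w \<in> project_weights F ` solutions (potential_lp \<T> F \<sigma>)" by blast
qed

end
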